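(* (i) Let $G$ be a convex bounded domain in $\mathbb{C}$. Then $\mathbf{b}(G)\le 1.7267$. (ii) Let $G$ be a domain in $\mathbb{C}$ with $\widetilde G\ne\mathbb{C}$. Then $\mathbf{b}_a(G)\le 1.7267$.
   Context: A domain is a nonempty connected open set. $\Pi=\{s\in\mathbb{C}:\Re s>0\}$ is the right half-plane and $H^\infty(\Pi)$ is the space of bounded holomorphic functions on $\Pi$. For a domain $G\subset\mathbb{C}$, $\widetilde G$ denotes its convex hull. Isometric Bohr abscissa: for a domain $G\subset\mathbb{C}$ with $\widetilde G\ne\mathbb{C}$, $\mathbf{b}(G)$ is the infimum of those real $\sigma\ge 0$ such that for every $f\in H^\infty(\Pi)$ with $f(\Pi)\subset G$ that is represented in $\Pi$ by a convergent ordinary Dirichlet series $f(s)=\sum_{n=1}^\infty a_n n^{-s}$ one has $$\sum_{n=2}^\infty \frac{|a_n|}{n^\sigma}<\operatorname{dist}(a_1,\partial\widetilde G).$$ The quantity $\mathbf{b}_a(G)$ is defined in the same way, except that only those $f$ are considered whose Dirichlet series converges absolutely at every point of $\Pi$. *)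

theory Defs
  imports "HOL-Complex_Analysis.Complex_Analysis"
begin

definition complex_domain :: "complex set \<Rightarrow> bool" where
  "complex_domain G \<longleftrightarrow> G \<noteq> {} \<and> open G \<and> connected G"

definition right_half_plane :: "complex set" where
  "right_half_plane = {s. Re s > 0}"

definition H_infinity :: "(complex \<Rightarrow> complex) set" where
  "H_infinity = {f. f holomorphic_on right_half_plane \<and> bounded (f ` right_half_plane)}"

text \<open>A coefficient sequence \<open>a :: nat \<Rightarrow> complex\<close> is used only at indices \<open>n \<ge> 1\<close>; the value
  \<open>a 0\<close> is irrelevant, so series over \<open>n \<ge> 1\<close> (over \<open>n \<ge> 2\<close>) are written with \<open>n + 1\<close>
  (with \<open>n + 2\<close>).\<close>

definition dirichlet_term :: "(nat \<Rightarrow> complex) \<Rightarrow> complex \<Rightarrow> nat \<Rightarrow> complex" where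
  "dirichlet_term a s n = a n * of_nat n powr (- s)"

text \<open>Convergence is that of the ordered partial sums, possibly only conditional.\<close>

definition represented_by_dirichlet ::
    "(complex \<Rightarrow> complex) \<Rightarrow> (nat \<Rightarrow> complex) \<Rightarrow> bool" where
  "represented_by_dirichlet f a \<longleftrightarrow>
     (\<forall>s\<in>right_half_plane. (\<lambda>n. dirichlet_term a s (n + 1)) sums f s)"

definition dirichlet_abs_convergent :: "(nat \<Rightarrow> complex) \<Rightarrow> bool" where
  "dirichlet_abs_convergent a \<longleftrightarrow>
     (\<forall>s\<in>right_half_plane. summable (\<lambda>n. norm (dirichlet_term a s (n + 1))))"

text \<open>Summability is explicit because \<open>suminf\<close> has no meaningful value on a divergent real series:
  a divergent sum counts as \<open>\<infinity>\<close> and violates the inequality.\<close>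

definition bohr_inequality :: "complex set \<Rightarrow> (nat \<Rightarrow> complex) \<Rightarrow> real \<Rightarrow> bool" where
  "bohr_inequality G a \<sigma> \<longleftrightarrow>
     summable (\<lambda>n. norm (a (n + 2)) / real (n + 2) powr \<sigma>) \<and>
     (\<Sum>n. norm (a (n + 2)) / real (n + 2) powr \<sigma>) < infdist (a 1) (frontier (convex hull G))"

text \<open>The infima are taken in the extended reals, so that the infimum of the empty set is \<open>\<infinity>\<close>.
  Both quantities are meaningful for domains \<open>G\<close> with \<open>convex hull G \<noteq> UNIV\<close>; then the frontier
  of the hull is nonempty and \<open>infdist\<close> is the true distance.\<close>

definition bohr_abscissa :: "complex set \<Rightarrow> ereal" where
  "bohr_abscissa G = Inf (ereal ` {\<sigma>. \<sigma> \<ge> 0 \<and>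
     (\<forall>f a. f \<in> H_infinity \<and> f ` right_half_plane \<subseteq> G \<and> represented_by_dirichlet f a
        \<longrightarrow> bohr_inequality G a \<sigma>)})"

definition bohr_abscissa_abs :: "complex set \<Rightarrow> ereal" where
  "bohr_abscissa_abs G = Inf (ereal ` {\<sigma>. \<sigma> \<ge> 0 \<and>
     (\<forall>f a. f \<in> H_infinity \<and> f ` right_half_plane \<subseteq> G \<and> represented_by_dirichlet f a
        \<and> dirichlet_abs_convergent a \<longrightarrow> bohr_inequality G a \<sigma>)})"

end

theory Submission
  imports Defs "HOL-Computational_Algebra.Primes"
begin

text \<open>Both parts follow from one inequality: if \<open>f\<close> is bounded with values in \<open>G\<close> and has a Dirichlet
  series in the half-plane, the Bohr inequality holds at \<open>\<sigma> = 259/150 < 1.7267\<close>.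

  Let \<open>D\<close> be the distance of \<open>a 1\<close> from the boundary of the hull of \<open>G\<close>. A supporting line at a nearest
  boundary point turns \<open>f\<close>, after a translation and a rotation, into a function with nonnegative
  real part whose first coefficient has real part at most \<open>D\<close>. Multiplying the real part by the
  squared modulus of a trigonometric polynomial in the characters \<open>n powr (-it)\<close> and averaging over a
  vertical line shows that the matrix with entry \<open>a (m div n)\<close> if \<open>n dvd m\<close>, and \<open>0\<close> otherwise,
  defines a form with nonnegative real part (\<open>coefficient_form_nonneg\<close>). For a set \<open>A\<close> of integers
  \<open>\<ge> 2\<close> none of which divides another, this yields \<open>(\<Sum>n\<in>A. (norm (a n))\<^sup>2) \<le> (2 * D)\<^sup>2\<close>
  (\<open>sum_norm_square_antichain_le\<close>).

  The averages are needed on lines near the imaginary axis, where the series may converge only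
  conditionally. Vertical means of a bounded holomorphic function do not depend on the line
  (\<open>vertical_mean_shift\<close>), so they can be evaluated on \<open>Re s = 2\<close>, where the convergence is
  absolute. This is why one argument covers both parts.

  The integers with exactly \<open>k\<close> prime factors, counted with multiplicity, form such a set \<open>A\<close>.
  Cauchy-Schwarz on each of these layers gives
  \<open>(\<Sum>n\<ge>2. norm (a n) / n powr \<sigma>) \<le> 2 * D * (\<Sum>k\<ge>1. sqrt (W k))\<close>, where \<open>W k\<close> is the sum of
  \<open>n powr (-2 * \<sigma>)\<close> over layer \<open>k\<close>. What remains is the numerical fact that the last sum is below \<open>1/2\<close>
  (\<open>sum_sqrt_layer_weight_le\<close>). It is true by a margin of about \<open>4 / 10^5\<close>, which dictates the accuracy of
  the bounds on the layers.\<close>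

section \<open>Vertical means of bounded holomorphic functions\<close>

definition vertical_mean :: "(complex \<Rightarrow> complex) \<Rightarrow> real \<Rightarrow> real \<Rightarrow> complex" where
  "vertical_mean h x T = integral {-T..T} (\<lambda>t. h (Complex x t)) / of_real (2 * T)"

lemma continuous_on_vertical_line:
  assumes "h holomorphic_on right_half_plane" "x > 0"
  shows "continuous_on S (\<lambda>t. h (Complex x t))"
proof -
  have "continuous_on right_half_plane h"
    using assms(1) by (rule holomorphic_on_imp_continuous_on)
  moreover have "continuous_on S (\<lambda>t. Complex x t)"
    unfolding Complex_eq by (intro continuous_intros)
  moreover have "(\<lambda>t. Complex x t) ` S \<subseteq> right_half_plane"
    using assms(2) by (auto simp: right_half_plane_def)
  ultimately show ?thesis
    using continuous_on_compose2 by blast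
qed

lemma vertical_line_integrable:
  assumes "h holomorphic_on right_half_plane" "x > 0"
  shows "(\<lambda>t. h (Complex x t)) integrable_on {a..b}"
  using continuous_on_vertical_line[OF assms] by (rule integrable_continuous_interval)

lemma convex_open_right_half_plane:
  shows "convex right_half_plane" and "open right_half_plane"
  unfolding right_half_plane_def
  by (auto simp: convex_halfspace_Re_gt open_halfspace_Re_gt)

lemma vertical_mean_primitive:
  assumes F: "\<And>s. s \<in> right_half_plane \<Longrightarrow> (F has_field_derivative h s) (at s)"
    and "x > 0" "T > 0"
  shows "vertical_mean h x T = (F (Complex x T) - F (Complex x (-T))) / (2 * \<i> * of_real T)"
proof -
  have "((\<lambda>t. \<i> * h (Complex x t)) has_integral (F (Complex x T) - F (Complex x (-T)))) {-T..T}"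
  proof (rule fundamental_theorem_of_calculus)
    show "-T \<le> T" using assms by simp
    fix t assume "t \<in> {-T..T}"
    have "Complex x t \<in> right_half_plane"
      using \<open>x > 0\<close> by (simp add: right_half_plane_def)
    then have F': "(F has_field_derivative h (Complex x t)) (at (Complex x t))"
      by (rule F)
    have line: "((\<lambda>t. Complex x t) has_vector_derivative \<i>) (at t within {-T..T})"
      unfolding Complex_eq by (auto intro!: derivative_eq_intros)
    have "((F \<circ> Complex x) has_vector_derivative \<i> * h (Complex x t)) (at t within {-T..T})"
      by (rule field_vector_diff_chain_within[OF line has_field_derivative_at_within[OF F']])
    then show "((\<lambda>t. F (Complex x t)) has_vector_derivative \<i> * h (Complex x t)) (at t within {-T..T})"
      by (simp add: o_def)
  qed
  then have "((\<lambda>t. (- \<i>) * (\<i> * h (Complex x t))) has_integral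
      (- \<i>) * (F (Complex x T) - F (Complex x (-T)))) {-T..T}"
    by (rule has_integral_mult_right)
  then have eq: "integral {-T..T} (\<lambda>t. h (Complex x t)) = (- \<i>) * (F (Complex x T) - F (Complex x (-T)))"
    by (simp add: integral_unique)
  show ?thesis
    unfolding vertical_mean_def eq using \<open>T > 0\<close> by (simp add: field_simps)
qed

text \<open>Let \<open>F\<close> be a primitive of \<open>h\<close>. The mean over a vertical segment is a difference quotient of \<open>F\<close>
  at the two end points, and sliding the segment from abscissa \<open>x\<close> to \<open>y\<close> moves \<open>F\<close> at each end
  by at most \<open>M * (y - x)\<close>, which the division by \<open>T\<close> sends to zero.\<close>

lemma vertical_mean_shift:
  assumes h: "h holomorphic_on right_half_plane" and "0 < x" "x \<le> y"
    and M: "\<And>s. x \<le> Re s \<Longrightarrow> Re s \<le> y \<Longrightarrow> norm (h s) \<le> M"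
    and L: "(vertical_mean h y \<longlongrightarrow> L) at_top"
  shows "(vertical_mean h x \<longlongrightarrow> L) at_top"
proof -
  obtain F where F: "\<And>s. s \<in> right_half_plane \<Longrightarrow> (F has_field_derivative h s) (at s within right_half_plane)"
    using holomorphic_convex_primitive'[OF convex_open_right_half_plane h] by blast
  then have F': "\<And>s. s \<in> right_half_plane \<Longrightarrow> (F has_field_derivative h s) (at s)"
    by (simp add: at_within_open[OF _ convex_open_right_half_plane(2)])
  let ?S = "{s. x \<le> Re s \<and> Re s \<le> y}"
  have cS: "convex ?S"
    unfolding Collect_conj_eq
    by (intro convex_Int convex_halfspace_Re_ge convex_halfspace_Re_le)
  have S: "?S \<subseteq> right_half_plane"
    using \<open>0 < x\<close> by (auto simp: right_half_plane_def)
  have edge: "norm (F (Complex y t) - F (Complex x t)) \<le> M * (y - x)" for t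
  proof -
    have "norm (F (Complex y t) - F (Complex x t)) \<le> M * norm (Complex y t - Complex x t)"
    proof (rule field_differentiable_bound[OF cS])
      show "(F has_field_derivative h s) (at s within ?S)" if "s \<in> ?S" for s
        using F' S that by (meson has_field_derivative_at_within subsetD)
    qed (use M \<open>x \<le> y\<close> in auto)
    also have "norm (Complex y t - Complex x t) = y - x"
      using \<open>x \<le> y\<close> by (simp add: cmod_def)
    finally show ?thesis .
  qed
  have "norm (vertical_mean h x T - vertical_mean h y T) \<le> M * (y - x) / T" if "T > 0" for T
  proof -
    let ?a = "F (Complex y (-T)) - F (Complex x (-T))" and ?b = "F (Complex y T) - F (Complex x T)"
    have eq: "vertical_mean h x T - vertical_mean h y T = (?a - ?b) / (2 * \<i> * of_real T)"
      using vertical_mean_primitive[of F h, OF F' _ that] assms(2,3) that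
      by (simp add: diff_divide_distrib)
    have le: "norm (?a - ?b) \<le> 2 * (M * (y - x))"
      using norm_triangle_ineq4[of ?a ?b] edge[of T] edge[of "-T"] by linarith
    have "norm (vertical_mean h x T - vertical_mean h y T) = norm (?a - ?b) / (2 * T)"
      unfolding eq using that by (simp add: norm_divide norm_mult)
    also have "\<dots> \<le> 2 * (M * (y - x)) / (2 * T)"
      using le that by (intro divide_right_mono) auto
    finally show ?thesis by simp
  qed
  then have "eventually (\<lambda>T. norm (vertical_mean h x T - vertical_mean h y T) \<le> M * (y - x) / T) at_top"
    by (intro eventually_mono[OF eventually_gt_at_top[of 0]]) auto
  moreover have "((\<lambda>T. M * (y - x) / T) \<longlongrightarrow> 0) at_top"
    by (rule real_tendsto_divide_at_top[OF tendsto_const filterlim_ident])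
  ultimately have "((\<lambda>T. vertical_mean h x T - vertical_mean h y T) \<longlongrightarrow> 0) at_top"
    by (rule Lim_null_comparison)
  from tendsto_add[OF this L] show ?thesis by simp
qed

lemma vertical_mean_exp:
  assumes "x > 0"
  shows "(vertical_mean (\<lambda>s. exp (of_real l * s)) x \<longlongrightarrow> (if l = 0 then 1 else 0)) at_top"
proof (cases "l = 0")
  case True
  have "vertical_mean (\<lambda>s. exp (of_real l * s)) x T = 1" if "T > 0" for T
    using that True by (simp add: vertical_mean_def scaleR_conv_of_real)
  then have "eventually (\<lambda>T. vertical_mean (\<lambda>s. exp (of_real l * s)) x T = 1) at_top"
    by (intro eventually_mono[OF eventually_gt_at_top[of 0]]) auto
  then show ?thesis
    using True tendsto_eventually by auto
next
  case False
  have "norm (vertical_mean (\<lambda>s. exp (of_real l * s)) x T) \<le> (exp (l * x) / \<bar>l\<bar>) / T" if "T > 0" for T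
  proof -
    let ?F = "\<lambda>s. exp (of_real l * s) / of_real l"
    have "(?F has_field_derivative exp (of_real l * s)) (at s)" for s
      using False by (auto intro!: derivative_eq_intros)
    then have eq: "vertical_mean (\<lambda>s. exp (of_real l * s)) x T
        = (?F (Complex x T) - ?F (Complex x (-T))) / (2 * \<i> * of_real T)"
      using assms that by (intro vertical_mean_primitive) auto
    have "norm (?F (Complex x t)) = exp (l * x) / \<bar>l\<bar>" for t
      by (simp add: norm_divide)
    then have le: "norm (?F (Complex x T) - ?F (Complex x (-T))) \<le> 2 * (exp (l * x) / \<bar>l\<bar>)"
      using norm_triangle_ineq4[of "?F (Complex x T)" "?F (Complex x (-T))"] by simp
    have "norm (vertical_mean (\<lambda>s. exp (of_real l * s)) x T)
        = norm (?F (Complex x T) - ?F (Complex x (-T))) / (2 * T)"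
      unfolding eq using that by (simp add: norm_divide[of "_ - _"] norm_mult)
    also have "\<dots> \<le> 2 * (exp (l * x) / \<bar>l\<bar>) / (2 * T)"
      using le that by (intro divide_right_mono) auto
    finally show ?thesis by simp
  qed
  then have "eventually (\<lambda>T. norm (vertical_mean (\<lambda>s. exp (of_real l * s)) x T) \<le> (exp (l * x) / \<bar>l\<bar>) / T) at_top"
    by (intro eventually_mono[OF eventually_gt_at_top[of 0]]) auto
  moreover have "((\<lambda>T. (exp (l * x) / \<bar>l\<bar>) / T) \<longlongrightarrow> 0) at_top"
    by (rule real_tendsto_divide_at_top[OF tendsto_const filterlim_ident])
  ultimately show ?thesis
    using False by (simp add: Lim_null_comparison)
qed

lemma norm_of_nat_powr: "norm (of_nat (Suc n) powr (z::complex)) = real (Suc n) powr Re z"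
  using norm_powr_real_powr[of "of_nat (Suc n)" z] by simp

section \<open>Dirichlet coefficients as vertical means\<close>

text \<open>Convergence at \<open>1/2\<close> bounds the terms there, so on the line \<open>Re s = 2\<close> the series is
  dominated by a multiple of \<open>\<Sum> n powr (-3/2)\<close>.\<close>

lemma dirichlet_series_uniform_limit:
  assumes rep: "represented_by_dirichlet f a"
  shows "uniform_limit {s. Re s = 2} (\<lambda>N s. \<Sum>n<N. dirichlet_term a s (n + 1)) f sequentially"
proof -
  have "(1/2::complex) \<in> right_half_plane"
    by (simp add: right_half_plane_def)
  then have "summable (\<lambda>n. dirichlet_term a (1/2) (n + 1))"
    using rep by (auto simp: represented_by_dirichlet_def sums_iff)
  then have "Bseq (\<lambda>n. dirichlet_term a (1/2) (n + 1))"
    using summable_LIMSEQ_zero convergent_imp_Bseq convergentI by blast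
  then obtain B where B: "\<And>n. norm (dirichlet_term a (1/2) (n + 1)) \<le> B"
    by (auto simp: Bseq_def)
  have bound: "norm (dirichlet_term a s (n + 1)) \<le> B * real (Suc n) powr (-3/2)" if "Re s = 2" for s n
  proof -
    have "norm (dirichlet_term a s (n + 1))
        = norm (dirichlet_term a (1/2) (n + 1)) * real (Suc n) powr (-3/2)"
      using that norm_of_nat_powr[of n "-s"] norm_of_nat_powr[of n "-1/2"]
      by (simp add: dirichlet_term_def norm_mult powr_add[symmetric])
    also have "\<dots> \<le> B * real (Suc n) powr (-3/2)"
      by (intro mult_right_mono B) auto
    finally show ?thesis .
  qed
  have "summable (\<lambda>n. real n powr (-3/2))"
    by (simp add: summable_real_powr_iff)
  then have "summable (\<lambda>n. B * real (Suc n) powr (-3/2))"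
    by (intro summable_mult) (subst summable_Suc_iff)
  then have "uniform_limit {s. Re s = 2} (\<lambda>N s. \<Sum>n<N. dirichlet_term a s (n + 1))
      (\<lambda>s. \<Sum>n. dirichlet_term a s (n + 1)) sequentially"
    using bound
    by (intro Weierstrass_m_test[where f = "\<lambda>n s. dirichlet_term a s (n + 1)"
          and M = "\<lambda>n. B * real (Suc n) powr (-3/2)"]) auto
  moreover have "(\<Sum>n. dirichlet_term a s (n + 1)) = f s" if "Re s = 2" for s
  proof -
    have "s \<in> right_half_plane" using that by (simp add: right_half_plane_def)
    then show ?thesis
      using rep by (auto simp: represented_by_dirichlet_def sums_iff)
  qed
  ultimately show ?thesis
    by (subst uniform_limit_cong'[where g = "\<lambda>N s. \<Sum>n<N. dirichlet_term a s (n + 1)"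
          and i = "\<lambda>s. \<Sum>n. dirichlet_term a s (n + 1)"]) simp_all
qed

lemma vertical_mean_diff_bound:
  assumes "g holomorphic_on right_half_plane" "h holomorphic_on right_half_plane" "x > 0" "T > 0"
    and B: "\<And>s. Re s = x \<Longrightarrow> norm (g s - h s) \<le> B"
  shows "norm (vertical_mean g x T - vertical_mean h x T) \<le> B"
proof -
  note int = vertical_line_integrable[OF _ \<open>x > 0\<close>]
  have "norm (integral {-T..T} (\<lambda>t. g (Complex x t) - h (Complex x t))) \<le> B * (T - (-T))"
    using B \<open>T > 0\<close> continuous_on_vertical_line[OF _ \<open>x > 0\<close>] assms(1,2)
    by (intro integral_bound continuous_intros) auto
  moreover have "integral {-T..T} (\<lambda>t. g (Complex x t) - h (Complex x t))
      = integral {-T..T} (\<lambda>t. g (Complex x t)) - integral {-T..T} (\<lambda>t. h (Complex x t))"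
    using assms(1,2) by (intro integral_diff int)
  ultimately show ?thesis
    using \<open>T > 0\<close>
    by (simp add: vertical_mean_def diff_divide_distrib[symmetric] norm_divide field_simps)
qed

lemma vertical_mean_sum:
  assumes "finite I" "\<And>i. i \<in> I \<Longrightarrow> h i holomorphic_on right_half_plane" "x > 0"
  shows "vertical_mean (\<lambda>s. \<Sum>i\<in>I. c i * h i s) x T = (\<Sum>i\<in>I. c i * vertical_mean (h i) x T)"
proof -
  have "integral {-T..T} (\<lambda>t. \<Sum>i\<in>I. c i * h i (Complex x t))
      = (\<Sum>i\<in>I. integral {-T..T} (\<lambda>t. c i * h i (Complex x t)))"
    using assms by (intro integral_sum integrable_on_mult_right vertical_line_integrable)
  then show ?thesis
    by (simp add: vertical_mean_def sum_divide_distrib)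
qed

text \<open>The Fourier-Bohr coefficients of \<open>f\<close> on any vertical line of the half-plane are the Dirichlet
  coefficients: for \<open>l = ln n\<close> the mean is \<open>a n\<close>, and it is zero if \<open>exp l\<close> is no positive integer.
  Only conditional convergence is available at abscissa \<open>x\<close>, so the mean is computed at abscissa \<open>2\<close>,
  where termwise integration is legitimate, and then carried back by shifting the line.\<close>

lemma vertical_mean_dirichlet_coefficient:
  assumes f: "f \<in> H_infinity" and rep: "represented_by_dirichlet f a"
    and x: "0 < x" "x \<le> 2"
    and L: "\<And>n. n \<ge> 1 \<Longrightarrow> real n = exp l \<Longrightarrow> a n = L"
      "(\<And>n. n \<ge> 1 \<Longrightarrow> real n \<noteq> exp l) \<Longrightarrow> L = 0"
  shows "(vertical_mean (\<lambda>s. exp (of_real l * s) * f s) x \<longlongrightarrow> L) at_top"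
proof -
  have fh: "f holomorphic_on right_half_plane" and "bounded (f ` right_half_plane)"
    using f by (auto simp: H_infinity_def)
  then obtain B where B: "\<And>s. s \<in> right_half_plane \<Longrightarrow> norm (f s) \<le> B"
    by (auto simp: bounded_iff)
  let ?h = "\<lambda>s. exp (of_real l * s) * f s"
  have hh: "?h holomorphic_on right_half_plane"
    by (intro holomorphic_intros fh)
  have h_bound: "norm (?h s) \<le> exp (\<bar>l\<bar> * 2) * B" if "x \<le> Re s" "Re s \<le> 2" for s
  proof -
    have "l * Re s \<le> \<bar>l\<bar> * Re s"
      using that x by (intro mult_right_mono) auto
    also have "\<dots> \<le> \<bar>l\<bar> * 2"
      using that by (intro mult_left_mono) auto
    finally have "l * Re s \<le> \<bar>l\<bar> * 2" .
    then show ?thesis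
      using B[of s] that x
      by (auto simp: norm_mult right_half_plane_def intro!: mult_mono)
  qed
  \<comment> \<open>The twisted partial sums, written as exponential polynomials.\<close>
  define P where "P = (\<lambda>N s. \<Sum>n<N. a (Suc n) * exp (of_real (l - ln (real (Suc n))) * s))"
  have P_eq: "P N s = exp (of_real l * s) * (\<Sum>n<N. dirichlet_term a s (n + 1))" for N s
    unfolding P_def dirichlet_term_def sum_distrib_left
  proof (rule sum.cong[OF refl])
    fix n
    have "Ln (of_nat (Suc n)) = of_real (ln (real (Suc n)))"
      using Ln_of_real[of "real (Suc n)"] by simp
    moreover have "of_nat (Suc n) \<noteq> (0::complex)"
      by (simp only: of_nat_eq_0_iff)
    ultimately have "of_nat (n + 1) powr - s = exp (- s * of_real (ln (real (Suc n))))"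
      by (simp add: powr_def)
    then show "a (Suc n) * exp (of_real (l - ln (real (Suc n))) * s) =
         exp (of_real l * s) * (a (n + 1) * of_nat (n + 1) powr - s)"
      by (simp add: algebra_simps flip: exp_add)
  qed
  have Ph: "P N holomorphic_on right_half_plane" for N
    unfolding P_def by (intro holomorphic_intros)
  have P_mean: "(vertical_mean (P N) 2 \<longlongrightarrow>
      (\<Sum>n<N. a (Suc n) * (if l - ln (real (Suc n)) = 0 then 1 else 0))) at_top" for N
  proof -
    have "vertical_mean (P N) 2 = (\<lambda>T. \<Sum>n<N. a (Suc n) *
        vertical_mean (\<lambda>s. exp (of_real (l - ln (real (Suc n))) * s)) 2 T)"
      unfolding P_def by (intro ext vertical_mean_sum holomorphic_intros) auto
    then show ?thesis
      by (simp only:) (intro tendsto_sum tendsto_mult tendsto_const vertical_mean_exp; simp)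
  qed
  \<comment> \<open>At most one frequency of a partial sum vanishes, so the mean picks out one coefficient.\<close>
  have P_coeff: "\<exists>N0. \<forall>N\<ge>N0. (\<Sum>n<N. a (Suc n) * (if l - ln (real (Suc n)) = 0 then 1 else 0)) = L"
  proof (cases "\<exists>n\<ge>1. real n = exp l")
    case True
    then obtain n where n: "n \<ge> 1" "real n = exp l" by auto
    then obtain m where m: "n = Suc m" by (cases n) auto
    have eq: "(l - ln (real (Suc k)) = 0) = (k = m)" for k
    proof -
      have "l = ln (real (Suc m))" using n m by simp
      then show ?thesis by auto
    qed
    show ?thesis
      unfolding eq using L(1)[OF n] m by (intro exI[of _ n]) (auto simp: if_distrib sum.delta cong: if_cong)
  next
    case False
    then have "l - ln (real (Suc k)) \<noteq> 0" for k
      by (metis exp_ln le_add1 of_nat_0_less_iff plus_1_eq_Suc right_minus_eq zero_less_Suc)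
    then show ?thesis using L(2) False by auto
  qed
  have "(vertical_mean ?h 2 \<longlongrightarrow> L) at_top"
  proof (rule tendstoI)
    fix e :: real assume "e > 0"
    define d where "d = e / 2 / exp (l * 2)"
    have "d > 0" using \<open>e > 0\<close> by (simp add: d_def)
    then have "eventually (\<lambda>N. \<forall>s\<in>{s. Re s = 2}. dist (\<Sum>n<N. dirichlet_term a s (n + 1)) (f s) < d) sequentially"
      using dirichlet_series_uniform_limit[OF rep] by (auto simp: uniform_limit_iff)
    moreover have "eventually (\<lambda>N. (\<Sum>n<N. a (Suc n) * (if l - ln (real (Suc n)) = 0 then 1 else 0)) = L) sequentially"
      using P_coeff by (simp add: eventually_sequentially)
    ultimately have "\<exists>N. (\<forall>s\<in>{s. Re s = 2}. dist (\<Sum>n<N. dirichlet_term a s (n + 1)) (f s) < d)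
        \<and> (\<Sum>n<N. a (Suc n) * (if l - ln (real (Suc n)) = 0 then 1 else 0)) = L"
      by (intro eventually_happens'[OF sequentially_bot] eventually_conj)
    then obtain N where N: "\<And>s. Re s = 2 \<Longrightarrow> dist (\<Sum>n<N. dirichlet_term a s (n + 1)) (f s) < d"
      and NL: "(\<Sum>n<N. a (Suc n) * (if l - ln (real (Suc n)) = 0 then 1 else 0)) = L"
      by blast
    have "norm (P N s - ?h s) \<le> e / 2" if "Re s = 2" for s
    proof -
      have "norm (P N s - ?h s) = exp (l * 2) * dist (\<Sum>n<N. dirichlet_term a s (n + 1)) (f s)"
        unfolding P_eq right_diff_distrib[symmetric] norm_mult dist_norm using that by simp
      also have "\<dots> \<le> exp (l * 2) * d"
        using N[OF that] by simp
      finally show ?thesis by (simp add: d_def)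
    qed
    then have close: "norm (vertical_mean (P N) 2 T - vertical_mean ?h 2 T) \<le> e / 2" if "T > 0" for T
      using that by (intro vertical_mean_diff_bound Ph hh) auto
    have "eventually (\<lambda>T. dist (vertical_mean (P N) 2 T) L < e / 2) at_top"
      using tendstoD[OF P_mean[of N, unfolded NL], of "e/2"] \<open>e > 0\<close> by simp
    then show "eventually (\<lambda>T. dist (vertical_mean ?h 2 T) L < e) at_top"
      using eventually_gt_at_top[of 0]
    proof eventually_elim
      case (elim T)
      then show ?case
        using close[of T] dist_triangle[of "vertical_mean ?h 2 T" L "vertical_mean (P N) 2 T"]
        by (simp add: dist_norm norm_minus_commute)
    qed
  qed
  then have lim: "(vertical_mean ?h 2 \<longlongrightarrow> L) at_top" .
  show ?thesis
    by (rule vertical_mean_shift[OF hh x _ lim]) (rule h_bound)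
qed

section \<open>Coefficients of functions with nonnegative real part\<close>

lemma vertical_mean_Re_nonneg:
  assumes "h holomorphic_on right_half_plane" "x > 0" "T > 0"
    and nonneg: "\<And>t. Re (h (Complex x t)) \<ge> 0"
  shows "Re (vertical_mean h x T) \<ge> 0"
proof -
  let ?i = "integral {-T..T} (\<lambda>t. h (Complex x t))"
  have "((\<lambda>t. h (Complex x t)) has_integral ?i) {-T..T}"
    using vertical_line_integrable[OF assms(1,2)] by (rule integrable_integral)
  then have "((\<lambda>t. Re (h (Complex x t))) has_integral Re ?i) {-T..T}"
    by (rule has_integral_Re)
  then have "Re ?i \<ge> 0"
    using nonneg by (intro has_integral_nonneg[of _ "Re ?i"]) auto
  moreover have "vertical_mean h x T = ?i / of_real (2 * T)"
    by (simp add: vertical_mean_def)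
  ultimately show ?thesis
    using \<open>T > 0\<close> by (simp only: Re_divide_of_real) simp
qed

text \<open>On the line \<open>Re s = x\<close> the function \<open>h\<close> of the proof equals \<open>f\<close> times the squared modulus of the
  trigonometric polynomial \<open>\<Sum>n\<in>A. c n * n powr (-it)\<close>, so its vertical mean has nonnegative real part.
  Expanding the square and taking means term by term gives the quadratic form: the frequency
  \<open>m / n\<close> contributes a coefficient exactly if \<open>n\<close> divides \<open>m\<close>. The exponential factor is the
  weight \<open>(n / m) powr x\<close> of the terms on that line.\<close>

lemma coefficient_form_on_line_nonneg:
  assumes f: "f \<in> H_infinity" and rep: "represented_by_dirichlet f a"
    and pos: "\<And>s. s \<in> right_half_plane \<Longrightarrow> Re (f s) \<ge> 0"
    and A: "finite A" "0 \<notin> A" and x: "0 < x" "x \<le> 2"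
  shows "Re (\<Sum>n\<in>A. \<Sum>m\<in>A. (c n * cnj (c m) * of_real (exp (x * (ln (real n) - ln (real m)))))
            * (if n dvd m then a (m div n) else 0)) \<ge> 0" (is "Re ?L \<ge> 0")
proof -
  have fh: "f holomorphic_on right_half_plane"
    using f by (auto simp: H_infinity_def)
  define d where "d = (\<lambda>p::nat\<times>nat. c (fst p) * cnj (c (snd p))
      * of_real (exp (x * (ln (real (fst p)) - ln (real (snd p))))))"
  define e where "e = (\<lambda>(p::nat\<times>nat) s. exp (of_real (ln (real (snd p)) - ln (real (fst p))) * s) * f s)"
  define h where "h = (\<lambda>s. \<Sum>p\<in>A\<times>A. d p * e p s)"
  have eh: "e p holomorphic_on right_half_plane" for p
    unfolding e_def by (intro holomorphic_intros fh)
  have h_eq: "h (Complex x t) = of_real ((norm (\<Sum>n\<in>A. c n * cis (- (t * ln (real n)))))\<^sup>2) * f (Complex x t)" for t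
  proof -
    have "d p * e p (Complex x t) = ((c (fst p) * cis (- (t * ln (real (fst p)))))
        * cnj (c (snd p) * cis (- (t * ln (real (snd p)))))) * f (Complex x t)" for p
    proof -
      have "of_real (exp (x * (ln (real (fst p)) - ln (real (snd p)))))
          * exp (of_real (ln (real (snd p)) - ln (real (fst p))) * Complex x t)
          = cis (t * (ln (real (snd p)) - ln (real (fst p))))"
        unfolding cis_conv_exp exp_of_real[symmetric] exp_add[symmetric] Complex_eq
        by (simp add: algebra_simps)
      also have "\<dots> = cis (- (t * ln (real (fst p)))) * cnj (cis (- (t * ln (real (snd p)))))"
        by (simp add: cis_mult cis_cnj algebra_simps)
      finally show ?thesis
        unfolding d_def e_def by (simp only: complex_cnj_mult ac_simps)
    qed
    then have "h (Complex x t) = (\<Sum>p\<in>A\<times>A. (c (fst p) * cis (- (t * ln (real (fst p)))))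
        * cnj (c (snd p) * cis (- (t * ln (real (snd p)))))) * f (Complex x t)"
      unfolding h_def by (simp add: sum_distrib_right)
    also have "(\<Sum>p\<in>A\<times>A. (c (fst p) * cis (- (t * ln (real (fst p)))))
        * cnj (c (snd p) * cis (- (t * ln (real (snd p))))))
        = (\<Sum>n\<in>A. c n * cis (- (t * ln (real n)))) * cnj (\<Sum>n\<in>A. c n * cis (- (t * ln (real n))))"
      by (simp add: sum_product sum.cartesian_product case_prod_beta)
    finally show ?thesis
      by (simp only: complex_norm_square)
  qed
  have "Re (vertical_mean h x T) \<ge> 0" if "T > 0" for T
  proof (rule vertical_mean_Re_nonneg[OF _ x(1) that])
    show "h holomorphic_on right_half_plane"
      unfolding h_def by (intro holomorphic_intros eh)
    show "Re (h (Complex x t)) \<ge> 0" for t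
      unfolding h_eq using pos[of "Complex x t"] x by (simp add: right_half_plane_def)
  qed
  then have "eventually (\<lambda>T. Re (vertical_mean h x T) \<ge> 0) at_top"
    by (intro eventually_mono[OF eventually_gt_at_top[of 0]]) auto
  moreover have "(vertical_mean h x \<longlongrightarrow> ?L) at_top"
  proof -
    have "vertical_mean h x = (\<lambda>T. \<Sum>p\<in>A\<times>A. d p * vertical_mean (e p) x T)"
      unfolding h_def using A by (intro ext vertical_mean_sum eh x) auto
    moreover have "(vertical_mean (e p) x \<longlongrightarrow>
        (if fst p dvd snd p then a (snd p div fst p) else 0)) at_top" if p: "p \<in> A \<times> A" for p
    proof -
      obtain n m where nm: "p = (n, m)" by fastforce
      have pos': "n > 0" "m > 0" using p A nm by (auto intro: Nat.gr0I)
      have e: "exp (ln (real m) - ln (real n)) = real m / real n"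
        using pos' by (simp add: exp_diff)
      have "(vertical_mean (e (n, m)) x \<longlongrightarrow> (if n dvd m then a (m div n) else 0)) at_top"
        unfolding e_def fst_conv snd_conv
      proof (rule vertical_mean_dirichlet_coefficient[OF f rep x])
        fix k assume "k \<ge> 1" "real k = exp (ln (real m) - ln (real n))"
        then have "real (n * k) = real m"
          using pos' unfolding e by (simp add: field_simps)
        then have "m = n * k" by linarith
        then show "a k = (if n dvd m then a (m div n) else 0)"
          using pos' by simp
      next
        assume *: "\<And>k. k \<ge> 1 \<Longrightarrow> real k \<noteq> exp (ln (real m) - ln (real n))"
        have "\<not> n dvd m"
        proof
          assume "n dvd m"
          then obtain k where k: "m = n * k" by auto
          then have "k \<ge> 1" "real k = real m / real n" using pos' by auto
          then show False using * e by metis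
        qed
        then show "(if n dvd m then a (m div n) else 0) = 0" by simp
      qed
      then show ?thesis unfolding nm fst_conv snd_conv .
    qed
    ultimately have "(vertical_mean h x \<longlongrightarrow>
        (\<Sum>p\<in>A\<times>A. d p * (if fst p dvd snd p then a (snd p div fst p) else 0))) at_top"
      by (auto intro!: tendsto_intros)
    moreover have "(\<Sum>p\<in>A\<times>A. d p * (if fst p dvd snd p then a (snd p div fst p) else 0)) = ?L"
      unfolding d_def by (simp add: sum.cartesian_product case_prod_beta)
    ultimately show ?thesis by simp
  qed
  ultimately show ?thesis
    by (intro tendsto_lowerbound[OF tendsto_Re[of "vertical_mean h x" ?L at_top]]) auto
qed

text \<open>The weights of the preceding form tend to \<open>1\<close> as the line approaches the imaginary axis.\<close>

lemma coefficient_form_nonneg: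
  assumes f: "f \<in> H_infinity" and rep: "represented_by_dirichlet f a"
    and pos: "\<And>s. s \<in> right_half_plane \<Longrightarrow> Re (f s) \<ge> 0"
    and A: "finite A" "0 \<notin> A"
  shows "Re (\<Sum>n\<in>A. \<Sum>m\<in>A. c n * cnj (c m) * (if n dvd m then a (m div n) else 0)) \<ge> 0"
proof -
  let ?L = "\<lambda>x. \<Sum>n\<in>A. \<Sum>m\<in>A. (c n * cnj (c m) * of_real (exp (x * (ln (real n) - ln (real m)))))
            * (if n dvd m then a (m div n) else 0)"
  have "(?L \<longlongrightarrow> ?L 0) (at_right 0)"
    by (intro tendsto_intros)
  then have lim: "((\<lambda>x. Re (?L x)) \<longlongrightarrow> Re (?L 0)) (at_right 0)"
    by (rule tendsto_Re)
  have "eventually (\<lambda>x. x \<in> {0<..<2}) (at_right (0::real))"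
    by (rule eventually_at_right_real) simp
  then have "eventually (\<lambda>x. Re (?L x) \<ge> 0) (at_right 0)"
    by eventually_elim (rule coefficient_form_on_line_nonneg[OF f rep pos A]; simp)
  from tendsto_lowerbound[OF lim this] show ?thesis by simp
qed

text \<open>For an antichain \<open>A\<close> of the divisibility order, the form of the previous lemma on \<open>insert 1 A\<close> has
  no cross terms within \<open>A\<close>. With the value \<open>u\<close> at \<open>1\<close> and \<open>- v * a n\<close> at \<open>n \<in> A\<close> it reads
  \<open>Re (a 1) * (u\<^sup>2 + v\<^sup>2 * Q) - u * v * Q\<close>, where \<open>Q\<close> is the sum to be bounded. In measure terms,
  the characters belonging to \<open>A\<close> are orthogonal and the lemma is Bessel's inequality for the
  constant function, with a factor \<open>2\<close> because \<open>a n\<close> is twice a Fourier coefficient.\<close>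

lemma sum_norm_square_antichain_le:
  assumes f: "f \<in> H_infinity" and rep: "represented_by_dirichlet f a"
    and pos: "\<And>s. s \<in> right_half_plane \<Longrightarrow> Re (f s) \<ge> 0"
    and A: "finite A" "\<And>n. n \<in> A \<Longrightarrow> n \<ge> 2"
    and antichain: "\<And>n m. n \<in> A \<Longrightarrow> m \<in> A \<Longrightarrow> n dvd m \<Longrightarrow> n = m"
  shows "Re (a 1) \<ge> 0" and "(\<Sum>n\<in>A. (norm (a n))\<^sup>2) \<le> 4 * (Re (a 1))\<^sup>2"
proof -
  define Q where "Q = (\<Sum>n\<in>A. (norm (a n))\<^sup>2)"
  have Q0: "Q \<ge> 0" by (simp add: Q_def sum_nonneg)
  have A1: "1 \<notin> A" "0 \<notin> A" using A(2) by force+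
  have key: "Re (a 1) * (u\<^sup>2 + v\<^sup>2 * Q) - u * v * Q \<ge> 0" for u v :: real
  proof -
    define c where "c = (\<lambda>n. if n = 1 then of_real u else - of_real v * a n)"
    define k where "k = (\<lambda>n m. if n dvd m then a (m div n) else (0::complex))"
    have kA: "k n m = (if n = m then a 1 else 0)" if "n \<in> A" "m \<in> A" for n m
      using antichain[OF that] that A(2)[of n] by (auto simp: k_def)
    have k1: "k n 1 = 0" if "n \<in> A" for n
      using that A1 by (auto simp: k_def)
    have "0 \<le> Re (\<Sum>n\<in>insert 1 A. \<Sum>m\<in>insert 1 A. c n * cnj (c m) * k n m)"
      unfolding k_def using A(1) A1 by (intro coefficient_form_nonneg[OF f rep pos]) auto
    also have "(\<Sum>n\<in>insert 1 A. \<Sum>m\<in>insert 1 A. c n * cnj (c m) * k n m)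
        = (c 1 * cnj (c 1) * k 1 1 + (\<Sum>m\<in>A. c 1 * cnj (c m) * k 1 m))
          + (\<Sum>n\<in>A. c n * cnj (c 1) * k n 1 + (\<Sum>m\<in>A. c n * cnj (c m) * k n m))"
      using A(1) A1 by simp
    also have "(\<Sum>n\<in>A. c n * cnj (c 1) * k n 1 + (\<Sum>m\<in>A. c n * cnj (c m) * k n m))
        = (\<Sum>n\<in>A. c n * cnj (c n) * a 1)"
    proof (rule sum.cong[OF refl])
      fix n assume n: "n \<in> A"
      have "(\<Sum>m\<in>A. c n * cnj (c m) * k n m) = (\<Sum>m\<in>A. if n = m then c n * cnj (c m) * a 1 else 0)"
        using kA n by (intro sum.cong) auto
      then show "c n * cnj (c 1) * k n 1 + (\<Sum>m\<in>A. c n * cnj (c m) * k n m) = c n * cnj (c n) * a 1"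
        using n A(1) k1[OF n] by simp
    qed
    also have "\<dots> = of_real (v\<^sup>2 * Q) * a 1"
    proof -
      have "c n * cnj (c n) * a 1 = of_real (v\<^sup>2 * (norm (a n))\<^sup>2) * a 1" if "n \<in> A" for n
      proof -
        have "c n * cnj (c n) = of_real (v\<^sup>2) * (a n * cnj (a n))"
          using that A1 by (auto simp: c_def power2_eq_square)
        then show ?thesis by (simp only: of_real_mult complex_norm_square)
      qed
      then show ?thesis
        unfolding Q_def sum_distrib_left of_real_sum sum_distrib_right by (intro sum.cong) auto
    qed
    also have "c 1 * cnj (c 1) * k 1 1 = of_real (u\<^sup>2) * a 1"
      by (simp add: c_def k_def power2_eq_square)
    also have "(\<Sum>m\<in>A. c 1 * cnj (c m) * k 1 m) = of_real (- (u * v * Q))"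
    proof -
      have "c 1 * cnj (c m) * k 1 m = of_real (- (u * v * (norm (a m))\<^sup>2))" if "m \<in> A" for m
      proof -
        have "c 1 * cnj (c m) * k 1 m = - (of_real (u * v) * (a m * cnj (a m)))"
          using that A1 by (auto simp: c_def k_def)
        then show ?thesis by (simp only: of_real_mult of_real_minus complex_norm_square)
      qed
      then show ?thesis by (simp add: Q_def sum_distrib_left sum_negf)
    qed
    finally show ?thesis by (simp add: algebra_simps)
  qed
  show nonneg: "Re (a 1) \<ge> 0" using key[of 1 0] by simp
  have "Q \<le> 4 * (Re (a 1))\<^sup>2"
  proof (cases "Re (a 1) = 0")
    case True
    then show ?thesis using key[of 1 1] Q0 by simp
  next
    case False
    then have p: "Re (a 1) > 0" using nonneg by simp
    have "0 \<le> Re (a 1) * (4 * (Re (a 1))\<^sup>2 - Q)"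
      using key[of "2 * Re (a 1)" 1] by (simp add: algebra_simps power2_eq_square)
    then show ?thesis using p by (simp add: zero_le_mult_iff)
  qed
  then show "(\<Sum>n\<in>A. (norm (a n))\<^sup>2) \<le> 4 * (Re (a 1))\<^sup>2" by (simp add: Q_def)
qed

section \<open>Weights of the layers of integers with k prime factors\<close>

abbreviation Omega :: "nat \<Rightarrow> nat" where
  "Omega n \<equiv> size (prime_factorization n)"

text \<open>The elements of \<open>Z\<close> are the primes sieved out so far. The truncation at \<open>N\<close> keeps all sums finite;
  every estimate below is uniform in \<open>N\<close>.\<close>

definition layer_weight :: "real \<Rightarrow> nat \<Rightarrow> nat set \<Rightarrow> nat \<Rightarrow> real" where
  "layer_weight s N Z k =
     (\<Sum>n | 1 \<le> n \<and> n \<le> N \<and> Omega n = k \<and> (\<forall>p\<in>Z. \<not> p dvd n). real n powr (- s))"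

lemma finite_layer: "finite {n. 1 \<le> n \<and> n \<le> (N::nat) \<and> P n}"
  by (rule finite_subset[of _ "{..N}"]) auto

lemma layer_weight_nonneg: "layer_weight s N Z k \<ge> 0"
  unfolding layer_weight_def by (intro sum_nonneg) auto

lemma Omega_mult: "n > 0 \<Longrightarrow> m > 0 \<Longrightarrow> Omega (n * m) = Omega n + Omega m"
  by (simp add: prime_factorization_mult)

lemma Omega_prime: "prime p \<Longrightarrow> Omega p = 1"
  by (simp add: prime_factorization_prime)

lemma Omega_eq_0_iff: "n > 0 \<Longrightarrow> Omega n = 0 \<longleftrightarrow> n = 1"
  by (auto simp: prime_factorization_empty_iff)

lemma Omega_eq_1_imp_prime:
  assumes "Omega n = 1"
  shows "prime n"
proof -
  obtain p where p: "prime_factorization n = {#p#}"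
    using size_1_singleton_mset[OF assms] by blast
  then have "n > 0" "prime p"
    using in_prime_factors_imp_prime[of p n] by (auto intro: Nat.gr0I)
  then show ?thesis
    using p prod_mset_prime_factorization_nat[of n] by simp
qed

lemma eq_of_dvd_Omega_eq:
  assumes "n dvd m" "Omega n = Omega m" "m > 0"
  shows "n = m"
proof -
  obtain k where k: "m = n * k" using assms(1) by auto
  then have "n > 0" "k > 0" using assms(3) by auto
  then show ?thesis
    using assms(2) Omega_mult[of n k] Omega_eq_0_iff[of k] k by simp
qed

lemma layer_weight_0: "layer_weight s N Z 0 \<le> 1"
proof -
  have "layer_weight s N Z 0 \<le> (\<Sum>n\<in>{1}. real n powr (-s))"
    unfolding layer_weight_def
    by (intro sum_mono2) (auto simp: prime_factorization_empty_iff)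
  then show ?thesis by simp
qed

text \<open>A number of the layer is either prime to \<open>p\<close>, or \<open>p\<close> times a number of the layer below.\<close>

lemma layer_weight_split:
  assumes p: "prime p"
  shows "layer_weight s N Z (Suc k)
     \<le> layer_weight s N (insert p Z) (Suc k) + real p powr (-s) * layer_weight s N Z k"
proof -
  define S where "S = (\<lambda>Z k. {n. 1 \<le> n \<and> n \<le> N \<and> Omega n = k \<and> (\<forall>p\<in>Z. \<not> p dvd n)})"
  have fin: "finite (S Z k)" for Z k
    unfolding S_def by (rule finite_layer)
  have lw: "layer_weight s N Z k = (\<Sum>n\<in>S Z k. real n powr (-s))" for Z k
    by (simp add: layer_weight_def S_def)
  have p0: "p > 0" using p by (simp add: prime_gt_0_nat)
  have sub: "S Z (Suc k) \<subseteq> S (insert p Z) (Suc k) \<union> (\<lambda>m. p * m) ` S Z k"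
  proof
    fix n assume n: "n \<in> S Z (Suc k)"
    show "n \<in> S (insert p Z) (Suc k) \<union> (\<lambda>m. p * m) ` S Z k"
    proof (cases "p dvd n")
      case True
      then obtain m where m: "n = p * m" by auto
      then have "m > 0" using n by (auto simp: S_def intro: Nat.gr0I)
      moreover have "m \<le> N"
        using m p0 n by (intro order.trans[of m n N]) (auto simp: S_def)
      ultimately have "m \<in> S Z k"
        using n m Omega_mult[of p m] Omega_prime[OF p] p0 by (auto simp: S_def)
      then show ?thesis using m by auto
    next
      case False
      then show ?thesis using n by (auto simp: S_def)
    qed
  qed
  have "layer_weight s N Z (Suc k) \<le> (\<Sum>n\<in>S (insert p Z) (Suc k) \<union> (\<lambda>m. p * m) ` S Z k. real n powr (-s))"
    unfolding lw using sub fin by (intro sum_mono2) auto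
  also have "\<dots> \<le> (\<Sum>n\<in>S (insert p Z) (Suc k). real n powr (-s)) + (\<Sum>n\<in>(\<lambda>m. p * m) ` S Z k. real n powr (-s))"
    using fin by (subst sum_Un) (auto intro!: sum_nonneg)
  also have "(\<Sum>n\<in>(\<lambda>m. p * m) ` S Z k. real n powr (-s)) = real p powr (-s) * layer_weight s N Z k"
    using p0 by (subst sum.reindex) (auto simp: inj_on_def lw sum_distrib_left powr_mult)
  finally show ?thesis by (simp add: lw)
qed

text \<open>Splitting off one prime factor embeds layer \<open>k + 1\<close> into the product of the layers \<open>1\<close> and \<open>k\<close>.
  The bound overcounts by the number of possible splittings, hence is reserved for layers from which
  small primes are removed and which are therefore small.\<close>

lemma layer_weight_Suc_le:
  "layer_weight s N Z (Suc k) \<le> layer_weight s N Z 1 * layer_weight s N Z k"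
proof -
  define S where "S = (\<lambda>k. {n. 1 \<le> n \<and> n \<le> N \<and> Omega n = k \<and> (\<forall>p\<in>Z. \<not> p dvd n)})"
  have fin: "finite (S k)" for k
    unfolding S_def by (rule finite_layer)
  have lw: "layer_weight s N Z k = (\<Sum>n\<in>S k. real n powr (-s))" for k
    by (simp add: layer_weight_def S_def)
  have sub: "S (Suc k) \<subseteq> (\<lambda>x. fst x * snd x) ` (S 1 \<times> S k)"
  proof
    fix n assume n: "n \<in> S (Suc k)"
    then have "n \<noteq> 1" by (auto simp: S_def)
    then obtain p where p: "prime p" "p dvd n"
      using prime_factor_nat by blast
    then obtain m where m: "n = p * m" by auto
    have p0: "p > 0" using p by (simp add: prime_gt_0_nat)
    have m0: "m > 0" using n m by (auto simp: S_def intro: Nat.gr0I)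
    have "m \<le> n" "p \<le> n" "n \<le> N" using m p0 m0 n by (auto simp: S_def)
    then have "m \<le> N" "p \<le> N" by (blast intro: order.trans)+
    then have "m \<in> S k" "p \<in> S 1"
      using n m Omega_mult[of p m] Omega_prime[OF p(1)] p0 m0
      by (auto simp: S_def)
    then show "n \<in> (\<lambda>x. fst x * snd x) ` (S 1 \<times> S k)"
      using m by force
  qed
  have "layer_weight s N Z (Suc k) \<le> (\<Sum>n\<in>(\<lambda>x. fst x * snd x) ` (S 1 \<times> S k). real n powr (-s))"
    unfolding lw using sub fin by (intro sum_mono2) auto
  also have "\<dots> \<le> (\<Sum>x\<in>S 1 \<times> S k. real (fst x * snd x) powr (-s))"
    using sum_image_le[of "S 1 \<times> S k" "\<lambda>n. real n powr (-s)" "\<lambda>x. fst x * snd x"] fin by simp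
  also have "\<dots> = (\<Sum>x\<in>S 1 \<times> S k. real (fst x) powr (-s) * real (snd x) powr (-s))"
    by (simp add: powr_mult)
  also have "\<dots> = layer_weight s N Z 1 * layer_weight s N Z k"
    by (simp add: lw sum_product sum.cartesian_product case_prod_beta)
  finally show ?thesis .
qed

section \<open>Numerical bounds\<close>

text \<open>Reduces an upper bound on a real power to a comparison of integers. An exponent \<open>b / k\<close> slightly
  below \<open>s\<close> with a small denominator keeps these integers short.\<close>

lemma powr_le_of_power_le:
  fixes n u v b k :: nat
  assumes "n > 0" "v > 0" "k > 0" "real b / real k \<le> s" "v ^ k \<le> n ^ b * u ^ k"
  shows "real n powr (- s) \<le> real u / real v"
proof -
  have "real (v ^ k) \<le> real (n ^ b * u ^ k)"
    using assms(5) by (simp only: of_nat_le_iff)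
  then have vk: "real v ^ k \<le> real n ^ b * real u ^ k" by simp
  have "(real n powr (- (real b / real k))) ^ k = real n powr (- real b)"
    using assms(1,3) by (simp add: powr_realpow[symmetric] powr_powr)
  also have "\<dots> = 1 / real n ^ b"
    using assms(1) by (simp add: powr_minus powr_realpow divide_inverse)
  also have "\<dots> \<le> (real u / real v) ^ k"
    using assms(1,2) vk by (simp add: field_simps power_divide)
  finally have "real n powr (- (real b / real k)) \<le> real u / real v"
    by (rule power_mono_iff[THEN iffD1, rotated 3]) (use assms(3) in auto)
  moreover have "real n powr (- s) \<le> real n powr (- (real b / real k))"
    using assms(1,4) by (simp add: powr_mono)
  ultimately show ?thesis by linarith
qed

text \<open>The sum telescopes after comparing \<open>1 / t^3\<close> with \<open>1 / ((t - 2) * t * (t + 2))\<close>.\<close>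

lemma sum_odd_cubes_le:
  fixes m :: real
  assumes "m > 2"
  shows "(\<Sum>i<K. 1 / (m + 2 * real i) ^ 3) \<le> 1 / (4 * m * (m - 2))"
proof -
  have "(\<Sum>i<K. 1 / (m + 2 * real i) ^ 3)
      \<le> 1 / (4 * m * (m - 2)) - 1 / (4 * (m + 2 * real K) * (m + 2 * real K - 2))"
  proof (induction K)
    case (Suc K)
    define t where "t = m + 2 * real K"
    have t: "t > 2" using assms by (simp add: t_def)
    then have "t * (t - 2) * (t + 2) \<le> t ^ 3"
      by (simp add: power3_eq_cube algebra_simps)
    then have "1 / t ^ 3 \<le> 1 / (t * (t - 2) * (t + 2))"
      using t by (intro divide_left_mono) auto
    also have "\<dots> = 1 / (4 * t * (t - 2)) - 1 / (4 * (t + 2) * t)"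
      using t by (simp add: divide_simps) (simp add: algebra_simps)
    finally show ?case using Suc by (simp add: t_def algebra_simps)
  qed simp
  also have "\<dots> \<le> 1 / (4 * m * (m - 2))"
    using assms by simp
  finally show ?thesis .
qed

text \<open>The exponent \<open>259/75\<close> equals \<open>2 * \<sigma>\<close> for \<open>\<sigma> = 259/150\<close>, a fraction just below \<open>1.7267\<close>. The total
  to be estimated stays below its limit by a few parts in \<open>10^5\<close> only, so the powers of \<open>2\<close>, \<open>3\<close>, \<open>5\<close>
  are bounded with the exact exponent. The larger a prime, the less it weighs, and
  the fractions \<open>145/42\<close>, \<open>69/20\<close>, \<open>31/9\<close>, all below \<open>259/75\<close>, are accurate enough for it.\<close>

lemma powr_bound_2:
  "real 2 powr (- (259/75)) \<le> real 9129418 / real (10^8)"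
  by (rule powr_le_of_power_le[where b = 259 and k = 75], simp, simp, simp, simp,
      simp only: power_numeral pow.simps sqr.simps arith_simps rel_simps)+

lemma powr_bound_3:
  "real 3 powr (- (259/75)) \<le> real 2250823 / real (10^8)"
  by (rule powr_le_of_power_le[where b = 259 and k = 75], simp, simp, simp, simp,
      simp only: power_numeral pow.simps sqr.simps arith_simps rel_simps)+

lemma powr_bound_5:
  "real 5 powr (- (259/75)) \<le> real 385677 / real (10^8)"
  by (rule powr_le_of_power_le[where b = 259 and k = 75], simp, simp, simp, simp,
      simp only: power_numeral pow.simps sqr.simps arith_simps rel_simps)+

lemma powr_bounds_7_to_13:
  "real 7 powr (- (259/75)) \<le> real 120893 / real (10^8)"
  "real 11 powr (- (259/75)) \<le> real 25394 / real (10^8)"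
  "real 13 powr (- (259/75)) \<le> real 14265 / real (10^8)"
  by (rule powr_le_of_power_le[where b = 145 and k = 42], simp, simp, simp, simp,
      simp only: power_numeral pow.simps sqr.simps arith_simps rel_simps)+

lemma powr_bounds_17_to_23:
  "real 17 powr (- (259/75)) \<le> real 5688 / real (10^8)"
  "real 19 powr (- (259/75)) \<le> real 3876 / real (10^8)"
  "real 23 powr (- (259/75)) \<le> real 2005 / real (10^8)"
  by (rule powr_le_of_power_le[where b = 69 and k = 20], simp, simp, simp, simp,
      simp only: power_numeral pow.simps sqr.simps arith_simps rel_simps)+

lemma powr_bounds_29_to_73:
  "real 29 powr (- (259/75)) \<le> real 919 / real (10^8)"
  "real 31 powr (- (259/75)) \<le> real 730 / real (10^8)"
  "real 37 powr (- (259/75)) \<le> real 397 / real (10^8)"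
  "real 41 powr (- (259/75)) \<le> real 279 / real (10^8)"
  "real 43 powr (- (259/75)) \<le> real 237 / real (10^8)"
  "real 47 powr (- (259/75)) \<le> real 175 / real (10^8)"
  "real 53 powr (- (259/75)) \<le> real 116 / real (10^8)"
  "real 59 powr (- (259/75)) \<le> real 80 / real (10^8)"
  "real 61 powr (- (259/75)) \<le> real 71 / real (10^8)"
  "real 67 powr (- (259/75)) \<le> real 52 / real (10^8)"
  "real 71 powr (- (259/75)) \<le> real 43 / real (10^8)"
  "real 73 powr (- (259/75)) \<le> real 39 / real (10^8)"
  by (rule powr_le_of_power_le[where b = 31 and k = 9], simp, simp, simp, simp,
      simp only: power_numeral pow.simps sqr.simps arith_simps rel_simps)+

lemma powr_75_bound: "real 75 powr (- (34/75)) \<le> real 1413 / real (10^4)"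
  by (rule powr_le_of_power_le[where b = 34 and k = 75], simp, simp, simp, simp,
      simp only: power_numeral pow.simps sqr.simps arith_simps rel_simps)

lemma primes_below_75:
  assumes "prime n" "n < 75" "\<not> 2 dvd n" "\<not> 3 dvd n" "\<not> 5 dvd n" "\<not> 7 dvd (n::nat)"
  shows "n \<in> {11,13,17,19,23,29,31,37,41,43,47,53,59,61,67,71,73}"
proof -
  have sieve: "filter (\<lambda>n. \<not> 2 dvd n \<and> \<not> 3 dvd n \<and> \<not> 5 dvd n \<and> \<not> 7 dvd n) [2..<75]
      = [11,13,17,19,23,29,31,37,41,43,47,53,59,61,67,71,73::nat]"
    by code_simp
  have "n \<in> set (filter (\<lambda>n. \<not> 2 dvd n \<and> \<not> 3 dvd n \<and> \<not> 5 dvd n \<and> \<not> 7 dvd n) [2..<75])"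
    unfolding set_filter set_upt using assms prime_ge_2_nat[of n] by simp
  then show ?thesis
    unfolding sieve by simp
qed

text \<open>The primes from \<open>11\<close> to \<open>73\<close> are bounded one by one. From \<open>75\<close> on all odd numbers are admitted,
  and \<open>n powr (-259/75)\<close> is split as \<open>n powr (-34/75) * n powr (-3)\<close>, with the first factor at most its value
  at \<open>75\<close> and the second summed by telescoping.\<close>

lemma layer_weight_large_primes:
  "layer_weight (259/75) N {2,3,5,7} 1 \<le> 5502 / 10^7"
proof -
  let ?w = "\<lambda>n. real n powr (- (259/75))"
  let ?L = "{11,13,17,19,23,29,31,37,41,43,47,53,59,61,67,71,73} :: nat set"
  let ?O = "(\<lambda>i. 75 + 2 * i) ` {..<N} :: nat set"
  have sub: "{n. 1 \<le> n \<and> n \<le> N \<and> Omega n = 1 \<and> (\<forall>p\<in>{2,3,5,7}. \<not> p dvd n)} \<subseteq> ?L \<union> ?O"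
  proof
    fix n assume n: "n \<in> {n. 1 \<le> n \<and> n \<le> N \<and> Omega n = 1 \<and> (\<forall>p\<in>{2,3,5,7}. \<not> p dvd n)}"
    then have pr: "prime n" using Omega_eq_1_imp_prime by auto
    show "n \<in> ?L \<union> ?O"
    proof (cases "n < 75")
      case True
      then show ?thesis using primes_below_75[OF pr] n by blast
    next
      case False
      have "odd n" using n by simp
      then obtain j where j: "n = 2 * j + 1" by (rule oddE)
      then have "n = 75 + 2 * (j - 37)" "j - 37 < N" using n False by auto
      then show ?thesis by blast
    qed
  qed
  have "layer_weight (259/75) N {2,3,5,7} 1 \<le> sum ?w (?L \<union> ?O)"
    unfolding layer_weight_def using sub by (intro sum_mono2) auto
  also have "\<dots> \<le> sum ?w ?L + sum ?w ?O"
    by (subst sum_Un) (auto intro!: sum_nonneg)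
  also have "sum ?w ?O \<le> 1413 / 10000 * (1 / (4 * 75 * 73))"
  proof -
    have "sum ?w ?O = (\<Sum>i<N. ?w (75 + 2 * i))"
      by (subst sum.reindex) (auto simp: inj_on_def)
    also have "\<dots> \<le> (\<Sum>i<N. 1413 / 10000 * (1 / (75 + 2 * real i) ^ 3))"
    proof (rule sum_mono)
      fix i
      let ?x = "75 + 2 * real i"
      have "?x powr (- (34/75)) \<le> 75 powr (- (34/75))"
        by (rule powr_mono2') auto
      then have "?x powr (- (34/75)) \<le> 1413 / 10000"
        using powr_75_bound by simp
      moreover have "?x powr (- 3) = 1 / ?x ^ 3"
        using powr_realpow[of ?x 3] by (simp add: powr_minus divide_inverse)
      moreover have "?x powr (- (259/75)) = ?x powr (- (34/75)) * ?x powr (- 3)"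
        by (simp flip: powr_add)
      moreover have "0 \<le> 1 / ?x ^ 3" by simp
      ultimately have "?x powr (- (259/75)) \<le> 1413 / 10000 * (1 / ?x ^ 3)"
        by (metis mult_right_mono)
      then show "?w (75 + 2 * i) \<le> 1413 / 10000 * (1 / ?x ^ 3)"
        by (simp only: of_nat_add of_nat_mult of_nat_numeral)
    qed
    also have "\<dots> \<le> 1413 / 10000 * (1 / (4 * 75 * 73))"
      unfolding sum_distrib_left[symmetric]
      using sum_odd_cubes_le[of 75 N] by (intro mult_left_mono) auto
    finally show ?thesis .
  qed
  also have "sum ?w ?L \<le> 54366 / 10^8"
    using powr_bounds_7_to_13 powr_bounds_17_to_23 powr_bounds_29_to_73 by simp
  finally show ?thesis by simp
qed

lemma layer_weight_step:
  assumes "prime p" "real p powr (-s) \<le> x"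
    and "layer_weight s N (insert p Z) (Suc k) \<le> u" "layer_weight s N Z k \<le> v"
    and "u + x * v \<le> w"
  shows "layer_weight s N Z (Suc k) \<le> w"
proof -
  have "layer_weight s N Z (Suc k)
      \<le> layer_weight s N (insert p Z) (Suc k) + real p powr (-s) * layer_weight s N Z k"
    by (rule layer_weight_split[OF assms(1)])
  also have "\<dots> \<le> u + x * v"
    using assms layer_weight_nonneg[of s N Z k] order.trans[OF powr_ge_zero assms(2)]
    by (intro add_mono mult_mono) auto
  finally show ?thesis using assms(5) by simp
qed

text \<open>The layers \<open>1\<close> to \<open>4\<close> are computed by restoring the primes \<open>7\<close>, \<open>5\<close>, \<open>3\<close>, \<open>2\<close> in turn, starting from the
  numbers prime to \<open>210\<close>. The stages are named by the letters \<open>e\<close> (nothing restored) down to \<open>a\<close> (all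
  restored), the index being the layer; each bound is the preceding rule evaluated and rounded up.\<close>

lemma layer_weight_bounds:
  fixes N :: nat
  defines "W \<equiv> layer_weight (259/75) N"
  shows "W {} 1 \<le> 11941831 / 10^8" "W {} 2 \<le> 11559312 / 10^9" "W {} 3 \<le> 10701847 / 10^10"
    "W {} 4 \<le> 9803711 / 10^11" "W {2} 1 \<le> 2812413 / 10^8" "W {2} 4 \<le> 33547 / 10^11"
proof -
  have p: "prime (2::nat)" "prime (3::nat)" "prime (5::nat)" "prime (7::nat)"
    by simp_all
  note b = powr_bound_2 powr_bound_3 powr_bound_5 powr_bounds_7_to_13(1)
  have st2: "W Z (Suc k) \<le> w" if "W (insert 2 Z) (Suc k) \<le> u" "W Z k \<le> v"
      "u + 9129418 / 10^8 * v \<le> w" for Z k u v w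
    unfolding W_def
    by (rule layer_weight_step[OF p(1) _ that[unfolded W_def]]) (use b in simp)
  have st3: "W Z (Suc k) \<le> w" if "W (insert 3 Z) (Suc k) \<le> u" "W Z k \<le> v"
      "u + 2250823 / 10^8 * v \<le> w" for Z k u v w
    unfolding W_def
    by (rule layer_weight_step[OF p(2) _ that[unfolded W_def]]) (use b in simp)
  have st5: "W Z (Suc k) \<le> w" if "W (insert 5 Z) (Suc k) \<le> u" "W Z k \<le> v"
      "u + 385677 / 10^8 * v \<le> w" for Z k u v w
    unfolding W_def
    by (rule layer_weight_step[OF p(3) _ that[unfolded W_def]]) (use b in simp)
  have st7: "W Z (Suc k) \<le> w" if "W (insert 7 Z) (Suc k) \<le> u" "W Z k \<le> v"
      "u + 120893 / 10^8 * v \<le> w" for Z k u v w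
    unfolding W_def
    by (rule layer_weight_step[OF p(4) _ that[unfolded W_def]]) (use b in simp)
  have z: "W Z 0 \<le> 1" for Z
    unfolding W_def by (rule layer_weight_0)
  define E where "E = {2,3,5,7::nat}"
  have E1: "W E 1 \<le> 5502 / 10^7"
    using layer_weight_large_primes[of N] by (simp add: W_def E_def)
  have E_Suc: "W E (Suc k) \<le> 5502 / 10^7 * v" if "W E k \<le> v" for k v
  proof -
    have "W E (Suc k) \<le> W E 1 * W E k"
      unfolding W_def by (rule layer_weight_Suc_le)
    also have "\<dots> \<le> 5502 / 10^7 * v"
      using E1 that layer_weight_nonneg[of "259/75" N E k] by (intro mult_mono) (auto simp: W_def)
    finally show ?thesis .
  qed
  have EE: "E = {7,5,3,2}" by (auto simp: E_def)
  have e1: "W {7,5,3,2} (Suc 0) \<le> 5502 / 10^7"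
    using E1 unfolding EE by simp
  have e2: "W {7,5,3,2} (Suc (Suc 0)) \<le> 302721 / 10^12"
    using E_Suc[OF E1] unfolding EE by (simp add: field_simps)
  have e3: "W {7,5,3,2} (Suc (Suc (Suc 0))) \<le> 167 / 10^12"
    using E_Suc[OF E_Suc[OF E1]] unfolding EE by (simp add: field_simps)
  have e4: "W {7,5,3,2} (Suc (Suc (Suc (Suc 0)))) \<le> 1 / 10^13"
    using E_Suc[OF E_Suc[OF E_Suc[OF E1]]] unfolding EE by (simp add: field_simps)
  have d1: "W {5,3,2} (Suc 0) \<le> 175913 / 10^8" by (rule st7[OF e1 z]) simp
  have d2: "W {5,3,2} (Suc (Suc 0)) \<le> 2430 / 10^9" by (rule st7[OF e2 d1]) simp
  have d3: "W {5,3,2} (Suc (Suc (Suc 0))) \<le> 32 / 10^10" by (rule st7[OF e3 d2]) simp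
  have d4: "W {5,3,2} (Suc (Suc (Suc (Suc 0)))) \<le> 1 / 10^11" by (rule st7[OF e4 d3]) simp
  have c1: "W {3,2} (Suc 0) \<le> 561590 / 10^8" by (rule st5[OF d1 z]) simp
  have c2: "W {3,2} (Suc (Suc 0)) \<le> 24090 / 10^9" by (rule st5[OF d2 c1]) simp
  have c3: "W {3,2} (Suc (Suc (Suc 0))) \<le> 962 / 10^10" by (rule st5[OF d3 c2]) simp
  have c4: "W {3,2} (Suc (Suc (Suc (Suc 0)))) \<le> 39 / 10^11" by (rule st5[OF d4 c3]) simp
  have b1: "W {2} (Suc 0) \<le> 2812413 / 10^8" by (rule st3[OF c1 z]) simp
  have b2: "W {2} (Suc (Suc 0)) \<le> 657115 / 10^9" by (rule st3[OF c2 b1]) simp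
  have b3: "W {2} (Suc (Suc (Suc 0))) \<le> 148867 / 10^10" by (rule st3[OF c3 b2]) simp
  have b4: "W {2} (Suc (Suc (Suc (Suc 0)))) \<le> 33547 / 10^11" by (rule st3[OF c4 b3]) simp
  have a1: "W {} (Suc 0) \<le> 11941831 / 10^8" by (rule st2[OF b1 z]) simp
  have a2: "W {} (Suc (Suc 0)) \<le> 11559312 / 10^9" by (rule st2[OF b2 a1]) simp
  have a3: "W {} (Suc (Suc (Suc 0))) \<le> 10701847 / 10^10" by (rule st2[OF b3 a2]) simp
  have a4: "W {} (Suc (Suc (Suc (Suc 0)))) \<le> 9803711 / 10^11" by (rule st2[OF b4 a3]) simp
  show "W {} 1 \<le> 11941831 / 10^8" "W {} 2 \<le> 11559312 / 10^9" "W {} 3 \<le> 10701847 / 10^10"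
    "W {} 4 \<le> 9803711 / 10^11" "W {2} 1 \<le> 2812413 / 10^8" "W {2} 4 \<le> 33547 / 10^11"
    using a1 a2 a3 a4 b1 b4 by (simp_all add: eval_nat_numeral)
qed

text \<open>From the fourth layer on the layers shrink essentially by \<open>2 powr (-259/75)\<close>, since most of the weight
  is carried by even numbers: the odd part of layer \<open>4\<close> is smaller than the
  whole by a factor near \<open>300\<close>. The ratio \<open>(3024/10^4)\<^sup>2\<close> leaves just enough room for the odd part, and
  the constant \<open>99014 / 10^7\<close> is the square root of the bound for layer \<open>4\<close>, rounded up.\<close>

lemma layer_weight_geometric:
  "layer_weight (259/75) N {} (j + 4) \<le> (99014 / 10^7)\<^sup>2 * (3024 / 10^4) ^ (2 * j)"
proof -
  define W where "W = layer_weight (259/75) N"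
  define r :: real where "r = 3024 / 10^4"
  have r2: "r\<^sup>2 = 914457600 / 10^10"
    by (simp add: r_def power2_eq_square)
  have "W {} (j + 4) \<le> 9803711 / 10^11 * (r\<^sup>2) ^ j \<and> W {2} (j + 4) \<le> 33547 / 10^11 * (r\<^sup>2) ^ j"
  proof (induction j)
    case 0
    then show ?case using layer_weight_bounds[of N] by (simp add: W_def)
  next
    case (Suc j)
    define q where "q = (r\<^sup>2) ^ j"
    have q: "q \<ge> 0" by (simp add: q_def)
    have "W {2} (Suc (j + 4)) \<le> W {2} 1 * W {2} (j + 4)"
      unfolding W_def by (rule layer_weight_Suc_le)
    also have "\<dots> \<le> 2812413 / 10^8 * (33547 / 10^11 * q)"
      using Suc layer_weight_bounds(5)[of N] layer_weight_nonneg[of "259/75" N "{2}" "j + 4"]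
      by (intro mult_mono) (auto simp: W_def q_def)
    finally have b: "W {2} (Suc (j + 4)) \<le> 2812413 / 10^8 * (33547 / 10^11 * q)" .
    have "W {} (Suc (j + 4)) \<le> 9803711 / 10^11 * (r\<^sup>2 * q)"
    proof -
      have "W {} (Suc (j + 4)) \<le> 2812413 / 10^8 * (33547 / 10^11 * q) + 9129418 / 10^8 * (9803711 / 10^11 * q)"
        unfolding W_def
        by (rule layer_weight_step[where p = 2 and x = "9129418 / 10^8"
              and v = "9803711 / 10^11 * q", OF _ _ b[unfolded W_def]])
          (use powr_bound_2 Suc in \<open>simp_all add: W_def q_def\<close>)
      also have "\<dots> \<le> 9803711 / 10^11 * (r\<^sup>2 * q)"
        unfolding r2 using q by simp
      finally show ?thesis .
    qed
    moreover have "2812413 / 10^8 * (33547 / 10^11 * q) \<le> 33547 / 10^11 * (r\<^sup>2 * q)"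
      unfolding r2 using q by simp
    ultimately show ?case using b by (simp add: q_def)
  qed
  then have "W {} (j + 4) \<le> 9803711 / 10^11 * r ^ (2 * j)"
    by (simp add: power_mult)
  also have "\<dots> \<le> (99014 / 10^7)\<^sup>2 * r ^ (2 * j)"
    by (intro mult_right_mono) (auto simp: power2_eq_square r_def)
  finally show ?thesis by (simp add: W_def r_def)
qed

text \<open>The square roots for the layers \<open>1\<close>, \<open>2\<close>, \<open>3\<close> and the geometric series for the rest add up to
  less than \<open>0.499992\<close>. That the bound is below \<open>1/2\<close> is the reason for the value of the abscissa.\<close>

lemma sum_sqrt_layer_weight_le:
  "(\<Sum>k\<in>{1..K}. sqrt (layer_weight (259/75) N {} k)) \<le> 499995 / 10^6"
proof -
  let ?g = "\<lambda>k. sqrt (layer_weight (259/75) N {} k)"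
  let ?r = "3024 / 10^4 :: real"
  have g0: "?g k \<ge> 0" for k
    using layer_weight_nonneg by simp
  have sub: "{1..K} \<subseteq> {1,2,3} \<union> (\<lambda>j. j + 4) ` {..<K}"
  proof
    fix k assume "k \<in> {1..K}"
    then have "k \<in> {1,2,3} \<or> k = (k - 4) + 4 \<and> k - 4 < K" by auto
    then show "k \<in> {1,2,3} \<union> (\<lambda>j. j + 4) ` {..<K}" by blast
  qed
  have "sum ?g {1..K} \<le> sum ?g ({1,2,3} \<union> (\<lambda>j. j + 4) ` {..<K})"
    using sub g0 by (intro sum_mono2) auto
  also have "\<dots> \<le> sum ?g {1,2,3} + sum ?g ((\<lambda>j. j + 4) ` {..<K})"
    using g0 by (subst sum_Un) (auto intro!: sum_nonneg)
  also have "sum ?g ((\<lambda>j. j + 4) ` {..<K}) = (\<Sum>j<K. ?g (j + 4))"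
    by (subst sum.reindex) (auto simp: inj_on_def)
  also have "\<dots> \<le> (\<Sum>j<K. 99014 / 10^7 * ?r ^ j)"
  proof (rule sum_mono)
    fix j
    have "(99014 / 10^7 * ?r ^ j)\<^sup>2 = (99014 / 10^7)\<^sup>2 * ?r ^ (2 * j)"
      by (simp only: power_mult_distrib power_mult[symmetric] mult.commute)
    then show "?g (j + 4) \<le> 99014 / 10^7 * ?r ^ j"
      using layer_weight_geometric[of N j]
      by (intro real_le_lsqrt) (auto simp: layer_weight_nonneg)
  qed
  also have "\<dots> \<le> 99014 / 10^7 * (1 / (1 - ?r))"
  proof -
    have "(\<Sum>j<K. ?r ^ j) \<le> (\<Sum>j. ?r ^ j)"
      by (intro sum_le_suminf summable_geometric) auto
    also have "\<dots> = 1 / (1 - ?r)"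
      by (intro suminf_geometric) simp
    finally show ?thesis
      unfolding sum_distrib_left[symmetric] by (intro mult_left_mono) auto
  qed
  also have "sum ?g {1,2,3} \<le> 3455696 / 10^7 + (1075143 / 10^7 + 327137 / 10^7)"
  proof -
    have sq: "sqrt w \<le> y" if "w \<le> v" "v \<le> y\<^sup>2" "0 \<le> y" for w v y :: real
      using that by (intro real_le_lsqrt) auto
    have "?g 1 \<le> 3455696 / 10^7"
      by (rule sq[OF layer_weight_bounds(1)]) (simp_all add: power2_eq_square)
    moreover have "?g 2 \<le> 1075143 / 10^7"
      by (rule sq[OF layer_weight_bounds(2)]) (simp_all add: power2_eq_square)
    moreover have "?g 3 \<le> 327137 / 10^7"
      by (rule sq[OF layer_weight_bounds(3)]) (simp_all add: power2_eq_square)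
    ultimately show ?thesis by simp
  qed
  finally show ?thesis by simp
qed

section \<open>The Bohr inequality\<close>

text \<open>The integers with exactly \<open>k\<close> prime factors form an antichain, so Cauchy-Schwarz on each layer
  bounds its contribution by \<open>B\<close> times the square root of its weight.\<close>

lemma sum_coefficients_le:
  fixes a :: "nat \<Rightarrow> complex"
  assumes B: "B \<ge> 0"
    and antichain: "\<And>A. finite A \<Longrightarrow> (\<And>n. n \<in> A \<Longrightarrow> n \<ge> 2)
        \<Longrightarrow> (\<And>n m. n \<in> A \<Longrightarrow> m \<in> A \<Longrightarrow> n dvd m \<Longrightarrow> n = m)
        \<Longrightarrow> (\<Sum>n\<in>A. (norm (a n))\<^sup>2) \<le> B\<^sup>2"
  shows "(\<Sum>n = 2..N. norm (a n) * real n powr (- (259/150))) \<le> B * (499995 / 10^6)"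
proof -
  let ?S = "{2..N}" and ?t = "\<lambda>n. norm (a n) * real n powr (- (259/150))"
  obtain K where K: "Omega ` ?S \<subseteq> {..K}"
    using finite_nat_iff_bounded_le[of "Omega ` ?S"] by auto
  have "Omega n \<in> {1..K}" if "n \<in> ?S" for n
  proof -
    have "Omega n \<noteq> 0"
      using that Omega_eq_0_iff[of n] by auto
    moreover have "Omega n \<le> K"
      using K that by (meson atMost_iff imageI subsetD)
    ultimately show ?thesis
      unfolding atLeastAtMost_iff by arith
  qed
  then have "Omega ` ?S \<subseteq> {1..K}" by (rule image_subsetI)
  then have "sum ?t ?S = (\<Sum>k\<in>{1..K}. sum ?t {n \<in> ?S. Omega n = k})"
    by (intro sum.group[symmetric]) auto
  also have "\<dots> \<le> (\<Sum>k\<in>{1..K}. B * sqrt (layer_weight (259/75) N {} k))"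
  proof (rule sum_mono)
    fix k assume k: "k \<in> {1..K}"
    let ?A = "{n \<in> ?S. Omega n = k}"
    have "sum ?t ?A \<le> L2_set (\<lambda>n. norm (a n)) ?A * L2_set (\<lambda>n. real n powr (- (259/150))) ?A"
      using L2_set_mult_ineq[of "\<lambda>n. norm (a n)" "\<lambda>n. real n powr (- (259/150))" ?A] by simp
    also have "\<dots> \<le> B * sqrt (layer_weight (259/75) N {} k)"
    proof (rule mult_mono)
      have "(\<Sum>n\<in>?A. (norm (a n))\<^sup>2) \<le> B\<^sup>2"
        by (rule antichain) (auto intro: eq_of_dvd_Omega_eq)
      then show "L2_set (\<lambda>n. norm (a n)) ?A \<le> B"
        unfolding L2_set_def using B by (intro real_le_lsqrt sum_nonneg) auto
      have "(\<Sum>n\<in>?A. (real n powr (- (259/150)))\<^sup>2) = (\<Sum>n\<in>?A. real n powr (- (259/75)))"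
        by (intro sum.cong) (auto simp: power2_eq_square simp flip: powr_add)
      also have "\<dots> \<le> layer_weight (259/75) N {} k"
        unfolding layer_weight_def by (intro sum_mono2) (auto simp: finite_layer)
      finally show "L2_set (\<lambda>n. real n powr (- (259/150))) ?A \<le> sqrt (layer_weight (259/75) N {} k)"
        unfolding L2_set_def by simp
    qed (use B in auto)
    finally show "sum ?t ?A \<le> B * sqrt (layer_weight (259/75) N {} k)" .
  qed
  also have "\<dots> \<le> B * (499995 / 10^6)"
    unfolding sum_distrib_left[symmetric]
    using sum_sqrt_layer_weight_le B by (intro mult_left_mono) auto
  finally show ?thesis .
qed

lemma represented_by_dirichlet_affine:
  assumes "represented_by_dirichlet f a"
  shows "represented_by_dirichlet (\<lambda>s. c * (f s - w)) (\<lambda>n. c * (a n - (if n = 1 then w else 0)))"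
  unfolding represented_by_dirichlet_def
proof
  fix s assume "s \<in> right_half_plane"
  then have "(\<lambda>n. dirichlet_term a s (n + 1)) sums f s"
    using assms by (simp add: represented_by_dirichlet_def)
  moreover have "(\<lambda>n. if n = 0 then w else 0) sums w"
    using sums_single[of 0 "\<lambda>_. w"] by simp
  ultimately have "(\<lambda>n. c * (dirichlet_term a s (n + 1) - (if n = 0 then w else 0))) sums (c * (f s - w))"
    by (intro sums_mult sums_diff)
  moreover have "c * (dirichlet_term a s (n + 1) - (if n = 0 then w else 0))
      = dirichlet_term (\<lambda>n. c * (a n - (if n = 1 then w else 0))) s (n + 1)" for n
    by (simp add: dirichlet_term_def algebra_simps)
  ultimately show "(\<lambda>n. dirichlet_term (\<lambda>n. c * (a n - (if n = 1 then w else 0))) s (n + 1))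
      sums (c * (f s - w))"
    by simp
qed

text \<open>Let \<open>w\<close> be a boundary point nearest to \<open>a 1\<close>. A supporting line at \<open>w\<close> puts \<open>H\<close> on one side, so
  a rotation of \<open>f - w\<close> has nonnegative real part. Its first coefficient has modulus
  \<open>dist (a 1) w\<close>, and its other coefficients have the moduli of those of \<open>f\<close>.\<close>

lemma antichain_le_infdist_frontier:
  assumes H: "open H" "convex H" "H \<noteq> {}" "H \<noteq> UNIV"
    and f: "f \<in> H_infinity" "f ` right_half_plane \<subseteq> H" "represented_by_dirichlet f a"
    and A: "finite A" "\<And>n. n \<in> A \<Longrightarrow> n \<ge> 2"
    and antichain: "\<And>n m. n \<in> A \<Longrightarrow> m \<in> A \<Longrightarrow> n dvd m \<Longrightarrow> n = m"
  shows "(\<Sum>n\<in>A. (norm (a n))\<^sup>2) \<le> (2 * infdist (a 1) (frontier H))\<^sup>2"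
proof -
  have "frontier H \<noteq> {}"
    using H by (simp add: frontier_eq_empty)
  then obtain w where w: "w \<in> frontier H" "infdist (a 1) (frontier H) = dist (a 1) w"
    using infdist_attains_inf[OF frontier_closed, of H "a 1"] by metis
  then have "w \<in> closure H" "w \<notin> rel_interior H"
    using H(1) rel_interior_subset[of H] by (auto simp: frontier_def interior_open)
  then obtain v where v: "v \<noteq> 0" "\<And>y. y \<in> closure H \<Longrightarrow> v \<bullet> w \<le> v \<bullet> y"
    using supporting_hyperplane_relative_frontier[OF H(2)] by metis
  define c where "c = cnj (sgn v)"
  have nc: "norm c = 1" using v by (simp add: c_def norm_sgn)
  define g where "g = (\<lambda>s. c * (f s - w))"
  define b where "b = (\<lambda>n. c * (a n - (if n = 1 then w else 0)))"
  have rep: "represented_by_dirichlet g b"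
    unfolding g_def b_def by (rule represented_by_dirichlet_affine[OF f(3)])
  have g: "g \<in> H_infinity"
  proof -
    have fh: "f holomorphic_on right_half_plane" and fb: "bounded (f ` right_half_plane)"
      using f(1) by (auto simp: H_infinity_def)
    obtain M where "\<And>s. s \<in> right_half_plane \<Longrightarrow> norm (f s) \<le> M"
      using fb by (auto simp: bounded_iff)
    then have "\<forall>s\<in>right_half_plane. norm (g s) \<le> M + norm w"
      unfolding g_def norm_mult nc
      by (auto intro: order.trans[OF norm_triangle_ineq4] add_right_mono)
    then have "bounded (g ` right_half_plane)"
      by (auto simp: bounded_iff)
    moreover have "g holomorphic_on right_half_plane"
      unfolding g_def by (intro holomorphic_intros fh)
    ultimately show ?thesis by (simp add: H_infinity_def)
  qed
  have pos: "Re (g s) \<ge> 0" if "s \<in> right_half_plane" for s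
  proof -
    have "f s \<in> closure H"
      using f(2) that closure_subset by blast
    then have "v \<bullet> (f s - w) \<ge> 0"
      using v(2) by (simp add: inner_diff_right)
    moreover have "Re (g s) = v \<bullet> (f s - w) / norm v"
      by (simp add: g_def c_def sgn_div_norm inner_complex_def divide_inverse algebra_simps)
    ultimately show ?thesis by simp
  qed
  have "(\<Sum>n\<in>A. (norm (a n))\<^sup>2) = (\<Sum>n\<in>A. (norm (b n))\<^sup>2)"
    using A(2) nc by (intro sum.cong) (force simp: b_def norm_mult)+
  also have "\<dots> \<le> 4 * (Re (b 1))\<^sup>2"
    by (rule sum_norm_square_antichain_le(2)[OF g rep pos A antichain])
  also have "\<dots> \<le> 4 * (norm (b 1))\<^sup>2"
    using abs_Re_le_cmod[of "b 1"] by (simp add: abs_le_square_iff[symmetric])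
  also have "norm (b 1) = infdist (a 1) (frontier H)"
    using w nc by (simp add: b_def norm_mult dist_norm)
  finally show ?thesis by (simp add: power_mult_distrib)
qed

text \<open>The bound \<open>2 * D * 0.499995\<close> is below the distance \<open>D\<close> of \<open>a 1\<close> from the frontier of the hull as soon as \<open>D\<close> is
  positive. Positivity needs an argument because \<open>a 1\<close> is only a limit of values of \<open>f\<close>: for \<open>D = 0\<close> all further
  coefficients vanish, so \<open>a 1\<close> is the constant value of \<open>f\<close> and lies in the open hull after all.\<close>

lemma bohr_inequality_hull:
  assumes G: "complex_domain G" "convex hull G \<noteq> UNIV"
    and f: "f \<in> H_infinity" "f ` right_half_plane \<subseteq> G" "represented_by_dirichlet f a"
  shows "bohr_inequality G a (259/150)"
proof -
  define H where "H = convex hull G"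
  define D where "D = infdist (a 1) (frontier H)"
  have H: "open H" "convex H" "H \<noteq> {}" "H \<noteq> UNIV"
    using G by (auto simp: H_def complex_domain_def open_convex_hull)
  have fH: "f ` right_half_plane \<subseteq> H"
    using f(2) hull_subset[of G convex] by (auto simp: H_def)
  have D0: "D \<ge> 0" by (simp add: D_def infdist_nonneg)
  note antichain = antichain_le_infdist_frontier[OF H f(1) fH f(3), folded D_def]
  have "D > 0"
  proof (rule ccontr)
    assume "\<not> D > 0"
    then have "D = 0" using D0 by simp
    have a0: "a n = 0" if "n \<ge> 2" for n
      using antichain[of "{n}"] that \<open>D = 0\<close> by simp
    have one: "1 \<in> right_half_plane" by (simp add: right_half_plane_def)
    then have "(\<lambda>n. dirichlet_term a 1 (n + 1)) sums f 1"
      using f(3) by (simp add: represented_by_dirichlet_def)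
    moreover have "(\<lambda>n. dirichlet_term a 1 (n + 1)) = (\<lambda>n. if n = 0 then a 1 else 0)"
      using a0 by (auto simp: dirichlet_term_def fun_eq_iff)
    moreover have "(\<lambda>n. if n = 0 then a 1 else 0) sums a 1"
      using sums_single[of 0 "\<lambda>_. a 1"] by simp
    ultimately have "f 1 = a 1"
      using sums_unique2 by metis
    then have "a 1 \<in> H"
      using fH one by auto
    moreover have "frontier H \<noteq> {}"
      using H by (simp add: frontier_eq_empty)
    then have "a 1 \<in> frontier H"
      using \<open>D = 0\<close> in_closed_iff_infdist_zero[OF frontier_closed, of H] by (simp add: D_def)
    ultimately show False
      using H(1) by (simp add: frontier_def interior_open)
  qed
  let ?t = "\<lambda>n. norm (a (n + 2)) / real (n + 2) powr (259/150)"
  have partial: "(\<Sum>n<N. ?t n) \<le> 2 * D * (499995 / 10^6)" for N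
  proof -
    have inj: "inj_on (\<lambda>n. n + 2) {..<N}" by (simp add: inj_on_def)
    have "(\<Sum>n<N. ?t n) = (\<Sum>n\<in>(\<lambda>n. n + 2) ` {..<N}. norm (a n) * real n powr (- (259/150)))"
      by (simp only: sum.reindex[OF inj] o_def powr_minus divide_inverse)
    also have "\<dots> \<le> (\<Sum>n = 2..N+2. norm (a n) * real n powr (- (259/150)))"
      by (intro sum_mono2) auto
    also have "\<dots> \<le> 2 * D * (499995 / 10^6)"
      using D0 by (intro sum_coefficients_le antichain) auto
    finally show ?thesis .
  qed
  have sm: "summable ?t"
    by (rule summableI_nonneg_bounded[OF _ partial]) simp
  have "suminf ?t \<le> 2 * D * (499995 / 10^6)"
    by (rule suminf_le_const[OF sm partial])
  also have "\<dots> < D" using \<open>D > 0\<close> by simp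
  finally show ?thesis
    using sm by (simp add: bohr_inequality_def D_def H_def)
qed

theorem theorem3p1:
  shows "(\<forall>G. complex_domain G \<and> convex G \<and> bounded G \<longrightarrow> bohr_abscissa G \<le> ereal 1.7267)
       \<and> (\<forall>G. complex_domain G \<and> convex hull G \<noteq> UNIV \<longrightarrow> bohr_abscissa_abs G \<le> ereal 1.7267)"
proof (intro conjI allI impI)
  have le: "ereal (259/150) \<le> ereal 1.7267" by simp
  fix G :: "complex set"
  {
    assume G: "complex_domain G \<and> convex G \<and> bounded G"
    then have hull: "convex hull G = G" by (simp add: hull_same)
    have "convex hull G \<noteq> UNIV"
      unfolding hull using G not_bounded_UNIV by auto
    then have "bohr_abscissa G \<le> ereal (259/150)"
      unfolding bohr_abscissa_def using G
      by (intro Inf_lower imageI) (auto intro: bohr_inequality_hull)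
    then show "bohr_abscissa G \<le> ereal 1.7267" using le by (rule order.trans)
  next
    assume G: "complex_domain G \<and> convex hull G \<noteq> UNIV"
    then have "bohr_abscissa_abs G \<le> ereal (259/150)"
      unfolding bohr_abscissa_abs_def
      by (intro Inf_lower imageI) (auto intro: bohr_inequality_hull)
    then show "bohr_abscissa_abs G \<le> ereal 1.7267" using le by (rule order.trans)
  }
qed

end
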